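(* Let $p\ge 7$ be a prime and write $\mathcal{B}_n=B_n/n$. Then $$\sum_{i=2}^{p-5}\mathcal{B}_i\,\mathcal{B}_{p-3-i}\equiv 2\,w_p\,\mathcal{B}_{p-3}-\sum_{a=1}^{p-1}\frac{q_a^2}{a^2}\pmod{p}.$$
   Context: $B_n$ denotes the $n$-th Bernoulli number and $\mathcal{B}_n=B_n/n$ the divided Bernoulli number. $w_p=\frac{(p-1)!+1}{p}$ is the Wilson quotient, and for $1\le a\le p-1$, $q_a=\frac{a^{p-1}-1}{p}$ is the Fermat quotient. Congruences are understood in $\mathbb{Z}_p$: $x\equiv y\pmod{p^k}$ means $x-y\in p^k\mathbb{Z}_p$. *)

theory Defs
  imports "HOL-Computational_Algebra.Computational_Algebra"
begin

(* Exponential generating function X / (e^X - 1) = (SUM n. B_n X^n / n!). Here "/" is division of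
   power series, which cancels the common factor X; hence B_1 = -1/2. *)
definition bernoulli_num :: "nat \<Rightarrow> rat" where
  "bernoulli_num n = fact n * fps_nth (fps_X / (fps_exp 1 - 1)) n"

lemma bernoulli_num_egf:
  "Abs_fps (\<lambda>n. bernoulli_num n / fact n) * (fps_exp 1 - 1) = fps_X"
proof -
  let ?D = "fps_exp (1::rat) - 1"
  have nz: "fps_nth ?D 1 \<noteq> 0" by simp
  have "subdegree ?D = 1" by (rule subdegreeI) auto
  then have "?D dvd fps_X"
    using nz by (subst fps_dvd_iff) (auto simp del: One_nat_def)
  then have "fps_X / ?D * ?D = fps_X" by simp
  moreover have "Abs_fps (\<lambda>n. bernoulli_num n / fact n) = fps_X / ?D"
    by (simp add: fps_eq_iff bernoulli_num_def)
  ultimately show ?thesis by simp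
qed

definition div_bernoulli :: "nat \<Rightarrow> rat" where
  "div_bernoulli n = bernoulli_num n / of_nat n"

definition wilson_quotient :: "nat \<Rightarrow> rat" where
  "wilson_quotient p = (fact (p - 1) + 1) / of_nat p"

definition fermat_quotient :: "nat \<Rightarrow> nat \<Rightarrow> rat" where
  "fermat_quotient p a = (of_nat a ^ (p - 1) - 1) / of_nat p"

(* The rational p-adic integers, i.e. the intersection of Z_p with Q: the fractions that can be
   written with a denominator prime to p. The denominator 0 is excluded because p divides 0. *)
definition padic_integral_rats :: "nat \<Rightarrow> rat set" where
  "padic_integral_rats p = {of_int a / of_int b | a b. \<not> int p dvd b}"

(* x - y lies in p^k Z_p. For rational x and y this is the same as x - y lying in
   p^k (Z_p \<inter> Q), because p^k is a nonzero rational. *)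
definition padic_cong :: "nat \<Rightarrow> nat \<Rightarrow> rat \<Rightarrow> rat \<Rightarrow> bool" where
  "padic_cong p k x y \<longleftrightarrow> (\<exists>z \<in> padic_integral_rats p. x - y = of_nat p ^ k * z)"

end

theory Submission
  imports Defs "HOL-Number_Theory.Number_Theory"
begin

text \<open>Let \<open>F(i) = \<Sum>\<^sub>a q\<^sub>a a\<^sup>i\<close> be the Mellin transform of the Fermat quotient modulo \<open>p\<close>.
  Since \<open>a\<^sup>p = a (1 + p q\<^sub>a)\<close>, the sum of the \<open>a\<^sup>p\<^sup>i\<close> is \<open>\<Sum>\<^sub>a a\<^sup>i + i p F(i)\<close> modulo \<open>p\<^sup>2\<close>, and it
  vanishes for \<open>0 < i < p - 1\<close>. As \<open>\<Sum>\<^sub>a a\<^sup>i\<close> is \<open>p B\<^sub>i\<close> modulo \<open>p\<^sup>2\<close>, this gives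
  \<open>F(i) = - B\<^sub>i / i\<close> modulo \<open>p\<close>, while \<open>F(0) = w\<^sub>p\<close> is Lerch's congruence. The theorem is
  then Parseval's identity for \<open>q\<^sub>a\<close>: the sum of \<open>F(i) F(j)\<close> over \<open>i + j = - 2\<close> modulo \<open>p - 1\<close>
  is \<open>- \<Sum>\<^sub>a q\<^sub>a\<^sup>2 / a\<^sup>2\<close>, and the terms of odd index vanish because one of the two factors
  is an odd moment of index at least three.\<close>

section \<open>Congruences modulo the square of a prime\<close>

text \<open>The difference of the powers is \<open>x - y\<close> times a sum of \<open>p\<close>
  terms. Modulo \<open>p\<close> these terms all equal \<open>y ^ (p - 1)\<close>, so both factors
  are divisible by \<open>p\<close>.\<close>

lemma cong_power_prime_square:
  fixes x y :: int
  assumes "[x = y] (mod int p)"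
  shows "[x ^ p = y ^ p] (mod int p ^ 2)"
proof -
  have "[(\<Sum>i<p. y ^ (p - Suc i) * x ^ i) = (\<Sum>i<p. y ^ (p - 1))] (mod int p)"
  proof (rule cong_sum)
    fix i assume "i \<in> {..<p}"
    then have "y ^ (p - 1) = y ^ (p - Suc i) * y ^ i"
      by (simp flip: power_add)
    then show "[y ^ (p - Suc i) * x ^ i = y ^ (p - 1)] (mod int p)"
      using assms by (auto intro!: cong_mult cong_pow)
  qed
  also have "[(\<Sum>i<p. y ^ (p - 1)) = 0] (mod int p)"
    by (simp add: cong_0_iff)
  finally have "int p dvd (\<Sum>i<p. y ^ (p - Suc i) * x ^ i)"
    by (simp add: cong_0_iff)
  moreover have "int p dvd x - y"
    using assms by (simp add: cong_iff_dvd_diff)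
  ultimately show ?thesis
    by (simp add: cong_iff_dvd_diff power_diff_sumr2 power2_eq_square mult_dvd_mono)
qed

lemma cong_one_add_power:
  fixes t m :: int
  shows "[(1 + m * t) ^ k = 1 + int k * m * t] (mod m ^ 2)"
proof (induction k)
  case (Suc k)
  have "(1 + m * t) ^ Suc k = (1 + m * t) * (1 + m * t) ^ k" by simp
  also have "[\<dots> = (1 + m * t) * (1 + int k * m * t)] (mod m ^ 2)"
    using Suc by (intro cong_mult cong_refl)
  also have "(1 + m * t) * (1 + int k * m * t) = 1 + int (Suc k) * m * t + m ^ 2 * (int k * t ^ 2)"
    by (simp add: algebra_simps power2_eq_square)
  also have "[\<dots> = 1 + int (Suc k) * m * t] (mod m ^ 2)"
    by (simp add: cong_iff_dvd_diff)
  finally show ?case .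
qed simp

text \<open>Cross terms carry the factor \<open>m ^ 2\<close>. This turns a product of the powers
  \<open>a ^ (p - 1)\<close> into a sum of Fermat quotients, as Lerch's congruence requires.\<close>

lemma cong_prod_one_add:
  fixes t :: "'a \<Rightarrow> int"
  assumes "finite A"
  shows "[(\<Prod>a\<in>A. 1 + m * t a) = 1 + m * (\<Sum>a\<in>A. t a)] (mod m ^ 2)"
  using assms
proof induction
  case (insert a A)
  have "(\<Prod>a\<in>insert a A. 1 + m * t a) = (1 + m * t a) * (\<Prod>a\<in>A. 1 + m * t a)"
    using insert by simp
  also have "[\<dots> = (1 + m * t a) * (1 + m * (\<Sum>a\<in>A. t a))] (mod m ^ 2)"
    using insert by (intro cong_mult cong_refl)
  also have "(1 + m * t a) * (1 + m * (\<Sum>a\<in>A. t a)) =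
      1 + m * (\<Sum>a\<in>insert a A. t a) + m ^ 2 * (t a * (\<Sum>a\<in>A. t a))"
    using insert by (simp add: algebra_simps power2_eq_square)
  also have "[\<dots> = 1 + m * (\<Sum>a\<in>insert a A. t a)] (mod m ^ 2)"
    by (simp add: cong_iff_dvd_diff)
  finally show ?case .
qed simp

section \<open>Power sums of the Teichmueller representatives\<close>

lemma bij_betw_mult_mod_prime:
  fixes p g :: nat
  assumes "prime p" and "coprime g p"
  shows "bij_betw (\<lambda>a. g * a mod p) {1..p - 1} {1..p - 1}"
proof -
  have inj: "inj_on (\<lambda>a. g * a mod p) {1..p - 1}"
  proof (rule inj_onI)
    fix a b assume ab: "a \<in> {1..p - 1}" "b \<in> {1..p - 1}" "g * a mod p = g * b mod p"
    then have "[a = b] (mod p)"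
      using assms cong_mult_lcancel_nat[of g p a b] by (simp add: cong_def)
    with ab show "a = b" by (auto simp: cong_def)
  qed
  moreover have "(\<lambda>a. g * a mod p) ` {1..p - 1} \<subseteq> {1..p - 1}"
  proof
    fix x assume "x \<in> (\<lambda>a. g * a mod p) ` {1..p - 1}"
    then obtain a where a: "a \<in> {1..p - 1}" "x = g * a mod p" by blast
    have "\<not> p dvd a" using a by (auto dest: dvd_imp_le)
    moreover have "\<not> p dvd g"
      using assms by (metis coprime_absorb_right not_prime_unit)
    ultimately have "\<not> p dvd g * a" using assms prime_dvd_mult_iff by blast
    moreover have "x < p" using a assms prime_gt_0_nat by simp
    ultimately show "x \<in> {1..p - 1}" using a by (auto simp: dvd_eq_mod_eq_0)
  qed
  ultimately show ?thesis
    by (simp add: bij_betw_def endo_inj_surj)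
qed

text \<open>A primitive root will do, because its order \<open>p - 1\<close> exceeds
  \<open>i\<close>.\<close>

lemma prime_power_not_cong_1_exists:
  fixes p i :: nat
  assumes "prime p" and "0 < i" and "i < p - 1"
  obtains g where "coprime g p" and "\<not> [g ^ i = 1] (mod p)"
proof -
  obtain g where "residue_primroot p g"
    using prime_primitive_root_exists[of p] assms prime_gt_1_nat by blast
  then have "coprime g p" and "ord p g = p - 1"
    using assms by (auto simp: residue_primroot_def totient_prime coprime_commute)
  then show ?thesis
    using that ord_minimal[of i p g] assms by simp
qed

text \<open>The \<open>p\<close>-th powers are the Teichmueller representatives modulo \<open>p\<^sup>2\<close>; multiplication by
  a suitable one of them permutes the summands and scales the sum by a non-trivial factor.\<close>
lemma sum_teichmueller_powers:
  fixes p i :: nat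
  assumes "prime p" and "0 < i" and "i < p - 1"
  shows "[(\<Sum>a = 1..p - 1. int a ^ (p * i)) = 0] (mod int p ^ 2)"
proof -
  obtain g where g: "coprime g p" "\<not> [g ^ i = 1] (mod p)"
    using prime_power_not_cong_1_exists assms by blast
  define T where "T = (\<Sum>a = 1..p - 1. int a ^ (p * i))"
  have "T = (\<Sum>a = 1..p - 1. int (g * a mod p) ^ (p * i))"
    unfolding T_def
    by (rule sum.reindex_bij_betw[OF bij_betw_mult_mod_prime[OF assms(1) g(1)], symmetric])
  \<comment> \<open>Dropping the reduction preserves \<open>g * a\<close> only modulo
    \<open>p\<close>, but its \<open>p\<close>-th power modulo \<open>p^2\<close>.\<close>
  also have "[\<dots> = (\<Sum>a = 1..p - 1. int (g * a) ^ (p * i))] (mod int p ^ 2)"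
    unfolding power_mult
    by (intro cong_sum cong_pow cong_power_prime_square) (simp add: cong_def zmod_int)
  also have "(\<Sum>a = 1..p - 1. int (g * a) ^ (p * i)) = int g ^ (p * i) * T"
    by (simp add: T_def power_mult_distrib sum_distrib_left)
  finally have "[int g ^ (p * i) * T = T] (mod int p ^ 2)" by (rule cong_sym)
  then have "int p ^ 2 dvd (int g ^ (p * i) - 1) * T"
    by (simp add: cong_iff_dvd_diff left_diff_distrib)
  \<comment> \<open>By Fermat \<open>g ^ (p * i)\<close> is \<open>g ^ i\<close> modulo
    \<open>p\<close>, which is not 1, so the scaling factor minus 1 is a unit and can be
    cancelled.\<close>
  moreover have "coprime (int p ^ 2) (int g ^ (p * i) - 1)"
  proof -
    have "[g ^ (p * i) = g ^ i] (mod p)"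
    proof -
      have "\<not> p dvd g" using g assms(1) by (metis coprime_absorb_right not_prime_unit)
      then have "[g ^ (p - 1) = 1] (mod p)" using fermat_theorem assms(1) by blast
      then have "[g * g ^ (p - 1) = g * 1] (mod p)" by (rule cong_scalar_left)
      moreover have "g * g ^ (p - 1) = g ^ p"
        using prime_gt_0_nat[OF assms(1)] by (simp flip: power_Suc)
      ultimately show ?thesis by (simp add: power_mult cong_pow)
    qed
    then have "\<not> [g ^ (p * i) = 1] (mod p)" using g(2) cong_trans cong_sym by blast
    then have "\<not> [int (g ^ (p * i)) = int 1] (mod int p)" by (subst cong_int_iff)
    then have "\<not> int p dvd int g ^ (p * i) - 1" by (simp add: cong_iff_dvd_diff)
    then show ?thesis
      using assms(1) by (simp add: prime_imp_coprime)
  qed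
  ultimately show ?thesis
    by (simp add: T_def coprime_dvd_mult_right_iff cong_0_iff)
qed

section \<open>Moments of the Fermat quotient\<close>

text \<open>Kept in the integers so that \<open>cong\<close> applies; for prime \<open>p\<close> and
  \<open>a\<close> prime to \<open>p\<close> the division is exact.\<close>

definition int_fermat_quotient :: "nat \<Rightarrow> nat \<Rightarrow> int" where
  "int_fermat_quotient p a = (int a ^ (p - 1) - 1) div int p"

lemma mult_int_fermat_quotient:
  assumes "prime p" and "a \<in> {1..p - 1}"
  shows "int a ^ (p - 1) = 1 + int p * int_fermat_quotient p a"
proof -
  have "\<not> p dvd a" using assms by (auto dest: dvd_imp_le)
  then have "[a ^ (p - 1) = 1] (mod p)" using assms fermat_theorem by blast
  then have "[int (a ^ (p - 1)) = int 1] (mod int p)" by (subst cong_int_iff)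
  then have "int p dvd int a ^ (p - 1) - 1" by (simp add: cong_iff_dvd_diff)
  then show ?thesis by (simp add: int_fermat_quotient_def)
qed

definition fermat_moment :: "nat \<Rightarrow> nat \<Rightarrow> int" where
  "fermat_moment p i = (\<Sum>a = 1..p - 1. int_fermat_quotient p a * int a ^ i)"

text \<open>Write \<open>a ^ (p * i)\<close> as \<open>(a ^ (p - 1)) ^ i * a ^ i\<close> and expand
  the first factor to first order in \<open>p\<close>; the sum over \<open>a\<close> vanishes by
  \<open>sum_teichmueller_powers\<close>.\<close>

lemma power_sum_fermat_moment:
  fixes p i :: nat
  assumes "prime p" and "0 < i" and "i < p - 1"
  shows "[(\<Sum>a = 1..p - 1. int a ^ i) + int i * int p * fermat_moment p i = 0] (mod int p ^ 2)"
proof -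
  have "[int a ^ (p * i) = int a ^ i + int i * int p * (int_fermat_quotient p a * int a ^ i)]
      (mod int p ^ 2)" if "a \<in> {1..p - 1}" for a
  proof -
    have "p * i = (p - 1) * i + i"
      using prime_gt_0_nat[OF assms(1)] by (cases p) auto
    then have "int a ^ (p * i) = (1 + int p * int_fermat_quotient p a) ^ i * int a ^ i"
      using mult_int_fermat_quotient[OF assms(1) that] by (simp add: power_add power_mult)
    also have "[\<dots> = (1 + int i * int p * int_fermat_quotient p a) * int a ^ i] (mod int p ^ 2)"
      by (intro cong_mult cong_refl cong_one_add_power)
    finally show ?thesis by (simp add: algebra_simps)
  qed
  then have "[(\<Sum>a = 1..p - 1. int a ^ (p * i)) =
      (\<Sum>a = 1..p - 1. int a ^ i + int i * int p * (int_fermat_quotient p a * int a ^ i))]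
      (mod int p ^ 2)"
    by (rule cong_sum)
  also have "(\<Sum>a = 1..p - 1. int a ^ i + int i * int p * (int_fermat_quotient p a * int a ^ i)) =
      (\<Sum>a = 1..p - 1. int a ^ i) + int i * int p * fermat_moment p i"
    by (simp add: fermat_moment_def sum.distrib sum_distrib_left)
  finally show ?thesis
    using sum_teichmueller_powers[OF assms] cong_trans cong_sym by blast
qed

lemma prime_dvd_power_sum:
  fixes p i :: nat
  assumes "prime p" and "0 < i" and "i < p - 1"
  shows "int p dvd (\<Sum>a = 1..p - 1. int a ^ i)"
proof -
  have "int p dvd (\<Sum>a = 1..p - 1. int a ^ i) + int i * int p * fermat_moment p i"
    using power_sum_fermat_moment[OF assms] by (auto simp: cong_0_iff power2_eq_square elim: dvd_mult_left)
  moreover have "int p dvd int i * int p * fermat_moment p i" by simp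
  ultimately show ?thesis using dvd_add_left_iff by blast
qed

text \<open>Pairing \<open>a\<close> with \<open>p - a\<close> gives
  \<open>2 * S = i * p * (\<Sum>a. a ^ (i - 1))\<close> modulo \<open>p^2\<close>. The sum on the
  right is divisible by \<open>p\<close> as \<open>i - 1\<close> is positive and below
  \<open>p - 1\<close>; for \<open>i = 1\<close> it would be \<open>p - 1\<close>. Hence
  \<open>p^2\<close> divides \<open>S\<close>, and \<open>power_sum_fermat_moment\<close> leaves
  \<open>p\<close> dividing \<open>i * F(i)\<close>.\<close>

lemma fermat_moment_odd:
  fixes p i :: nat
  assumes "prime p" and "odd i" and "2 < i" and "i < p - 1"
  shows "[fermat_moment p i = 0] (mod int p)"
proof -
  define S where "S = (\<Sum>a = 1..p - 1. int a ^ i)"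
  have p: "p > 3" using assms by simp
  have "S = (\<Sum>a = 1..p - 1. int (p - a) ^ i)"
    unfolding S_def
    by (rule sum.reindex_bij_witness[of _ "\<lambda>a. p - a" "\<lambda>a. p - a"]) auto
  also have "[\<dots> = (\<Sum>a = 1..p - 1. - (int a ^ i) + int i * int p * int a ^ (i - 1))] (mod int p ^ 2)"
  proof (rule cong_sum)
    fix a assume "a \<in> {1..p - 1}"
    then have a: "a \<le> p" by (auto intro: le_trans)
    have "int p ^ 2 dvd (int p - int a) ^ i - (- (int a ^ i) + int i * int p * int a ^ (i - 1))"
    proof -
      have "\<exists>k. (x - y) ^ n = (- y) ^ n + int n * x * (- y) ^ (n - 1) + x ^ 2 * k" for x y :: int and n
      proof (induction n)
        case (Suc n)
        then obtain k where k: "(x - y) ^ n = (- y) ^ n + int n * x * (- y) ^ (n - 1) + x ^ 2 * k"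
          by blast
        have "(x - y) ^ Suc n = (- y) ^ Suc n + int (Suc n) * x * (- y) ^ (Suc n - 1)
            + x ^ 2 * (int n * (- y) ^ (n - 1) + (x - y) * k)"
          \<comment> \<open>The case split is for \<open>n - 1\<close>, which truncates at
            \<open>n = 0\<close>; there the term has the coefficient 0.\<close>
          unfolding power_Suc k by (cases n) (simp_all add: algebra_simps power2_eq_square)
        then show ?case by blast
      qed (auto intro: exI[of _ 0])
      from this[of "int p" "int a" i] show ?thesis
        using assms by (auto simp: power_minus_odd)
    qed
    then show "[int (p - a) ^ i = - (int a ^ i) + int i * int p * int a ^ (i - 1)] (mod int p ^ 2)"
      using a by (simp add: cong_iff_dvd_diff of_nat_diff[of a p])
  qed
  also have "(\<Sum>a = 1..p - 1. - (int a ^ i) + int i * int p * int a ^ (i - 1)) =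
      - S + int i * (int p * (\<Sum>a = 1..p - 1. int a ^ (i - 1)))"
    unfolding S_def by (simp only: sum.distrib sum_negf mult.assoc flip: sum_distrib_left)
  finally have "[S = - S + int i * (int p * (\<Sum>a = 1..p - 1. int a ^ (i - 1)))] (mod int p ^ 2)" .
  moreover have "[- S + int i * (int p * (\<Sum>a = 1..p - 1. int a ^ (i - 1))) = - S + 0] (mod int p ^ 2)"
    using prime_dvd_power_sum[of p "i - 1"] assms
    by (intro cong_add cong_refl) (simp add: cong_0_iff power2_eq_square mult_dvd_mono)
  ultimately have "[S = - S + 0] (mod int p ^ 2)" using cong_trans by blast
  then have "int p ^ 2 dvd 2 * S" by (simp add: cong_iff_dvd_diff)
  moreover have "coprime (int p ^ 2) 2"
    using assms(1) p prime_odd_nat by simp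
  ultimately have "int p ^ 2 dvd S" by (simp add: coprime_dvd_mult_right_iff)
  moreover have "int p ^ 2 dvd S + int i * int p * fermat_moment p i"
    using power_sum_fermat_moment[of p i] assms by (simp add: S_def cong_0_iff)
  ultimately have "int p ^ 2 dvd int i * int p * fermat_moment p i"
    using dvd_add_right_iff by blast
  then have "int p dvd int i * fermat_moment p i"
    using p by (simp add: power2_eq_square mult.commute mult.left_commute)
  moreover have "\<not> int p dvd int i" using assms by (auto dest: dvd_imp_le)
  ultimately have "int p dvd fermat_moment p i"
    using assms(1) by (meson prime_dvd_multD prime_nat_int_transfer)
  then show ?thesis by (simp add: cong_0_iff)
qed

text \<open>Lerch's congruence: evaluate the product of all \<open>a ^ (p - 1)\<close> modulo
  \<open>p^2\<close> twice. Factor by factor it is \<open>1 + p * F(0)\<close>. It is also the power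
  \<open>p - 1\<close> of \<open>(p - 1)! = - (1 - p * w)\<close>; the exponent is even, so this is
  \<open>1 + p * w\<close>.\<close>

lemma fermat_moment_0:
  fixes p :: nat and w :: int
  assumes "prime p" and "odd p" and w: "fact (p - 1) + 1 = int p * w"
  shows "[fermat_moment p 0 = w] (mod int p)"
proof -
  have p: "p \<ge> 2" using assms prime_ge_2_nat by blast
  have "1 + int p * fermat_moment p 0 = 1 + int p * (\<Sum>a = 1..p - 1. int_fermat_quotient p a)"
    by (simp add: fermat_moment_def)
  also have "[\<dots> = (\<Prod>a = 1..p - 1. 1 + int p * int_fermat_quotient p a)] (mod int p ^ 2)"
    by (intro cong_sym[OF cong_prod_one_add]) simp
  also have "(\<Prod>a = 1..p - 1. 1 + int p * int_fermat_quotient p a) = (\<Prod>a = 1..p - 1. int a ^ (p - 1))"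
    by (intro prod.cong refl mult_int_fermat_quotient[OF assms(1), symmetric])
  also have "\<dots> = fact (p - 1) ^ (p - 1)"
    by (simp add: fact_prod flip: prod_power_distrib)
  also have "\<dots> = (1 + int p * (- w)) ^ (p - 1)"
  proof -
    have "fact (p - 1) = - (1 + int p * (- w))" using w by simp
    moreover have "even (p - 1)" using assms by simp
    ultimately show ?thesis by (simp only: power_minus_even)
  qed
  also have "[\<dots> = 1 + int (p - 1) * int p * (- w)] (mod int p ^ 2)"
    by (rule cong_one_add_power)
  also have "1 + int (p - 1) * int p * (- w) = 1 + int p * w - int p ^ 2 * w"
    using p by (simp add: of_nat_diff algebra_simps power2_eq_square)
  also have "[\<dots> = 1 + int p * w] (mod int p ^ 2)"
    by (simp add: cong_iff_dvd_diff)
  finally have "int p * int p dvd int p * (fermat_moment p 0 - w)"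
    by (simp add: cong_iff_dvd_diff algebra_simps power2_eq_square)
  then show ?thesis using p by (simp add: cong_iff_dvd_diff)
qed

text \<open>Orthogonality of the powers modulo \<open>p\<close>: summing
  \<open>a^i * b^(-2-i)\<close> over all residues \<open>i\<close> modulo \<open>p - 1\<close> gives
  \<open>- 1 / a^2\<close> if \<open>a = b\<close> and 0 otherwise. The range
  \<open>i \<le> p - 3\<close> omits just \<open>i = p - 2\<close>, whose term
  \<open>(a * b) ^ (p - 2)\<close> is therefore subtracted.\<close>

lemma complete_homogeneous_cong:
  fixes p a b :: nat
  assumes "prime p" and "p \<ge> 3" and "a \<in> {1..p - 1}" and "b \<in> {1..p - 1}"
  shows "[(\<Sum>i\<le>p - 3. int a ^ i * int b ^ (p - 3 - i)) =
     - ((int a * int b) ^ (p - 2)) - (if a = b then int a ^ (p - 3) else 0)] (mod int p)"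
proof -
  have fermat: "[int c ^ (p - 1) = 1] (mod int p)" if "c \<in> {1..p - 1}" for c
    using mult_int_fermat_quotient[OF assms(1) that] by (simp add: cong_iff_dvd_diff)
  have s: "p - 1 = Suc (p - 2)" "p - 2 = Suc (p - 3)" using assms by auto
  show ?thesis
  proof (cases "a = b")
    case True
    have "(\<Sum>i\<le>p - 3. int a ^ i * int b ^ (p - 3 - i)) = (\<Sum>i\<le>p - 3. int a ^ (p - 3))"
      using True by (intro sum.cong refl) (auto simp flip: power_add simp del: diff_diff_left)
    also have "\<dots> = (int p - 2) * int a ^ (p - 3)"
      using assms by (simp add: of_nat_diff)
    \<comment> \<open>The coefficient \<open>- 2\<close> is split: one copy, times
      \<open>a ^ (p - 1) = 1\<close>, becomes \<open>(a * b) ^ (p - 2)\<close>; the other is the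
      diagonal term.\<close>
    also have "[\<dots> = - (int a ^ (p - 3) * 1) - int a ^ (p - 3)] (mod int p)"
      by (simp add: cong_iff_dvd_diff algebra_simps)
    also have "[- (int a ^ (p - 3) * 1) - int a ^ (p - 3) =
        - (int a ^ (p - 3) * int a ^ (p - 1)) - int a ^ (p - 3)] (mod int p)"
      unfolding cong_minus_minus_iff
      by (intro cong_diff cong_refl iffD2[OF cong_minus_minus_iff] cong_scalar_left
            cong_sym[OF fermat[OF assms(3)]])
    also have "int a ^ (p - 3) * int a ^ (p - 1) = (int a * int b) ^ (p - 2)"
    proof -
      have "(p - 3) + (p - 1) = (p - 2) + (p - 2)" using assms by simp
      then show ?thesis using True by (simp add: power_mult_distrib flip: power_add)
    qed
    finally show ?thesis using True by simp
  next
    case False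
    define K where "K = (\<Sum>i\<le>p - 3. int a ^ i * int b ^ (p - 3 - i))"
    have "int a ^ (p - 2) - int b ^ (p - 2) = (int a - int b) * K"
      unfolding K_def s(2) diff_power_eq_sum lessThan_Suc_atMost by simp
    \<comment> \<open>After multiplication by \<open>a - b\<close>, a unit modulo \<open>p\<close>,
      the claim is a combination of the two Fermat congruences.\<close>
    then have "(int a - int b) * (K + (int a * int b) ^ (p - 2)) =
        int b ^ (p - 2) * (int a ^ (p - 1) - 1) - int a ^ (p - 2) * (int b ^ (p - 1) - 1)"
      unfolding s(1) by (simp add: algebra_simps power_mult_distrib)
    moreover have "int p dvd int a ^ (p - 1) - 1" "int p dvd int b ^ (p - 1) - 1"
      using fermat assms by (simp_all add: cong_iff_dvd_diff)
    ultimately have "int p dvd (int a - int b) * (K + (int a * int b) ^ (p - 2))"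
      by simp
    moreover have "\<not> int p dvd int a - int b"
    proof
      assume "int p dvd int a - int b"
      then have "[a = b] (mod p)" by (simp add: cong_iff_dvd_diff flip: cong_int_iff)
      with assms False show False by (auto simp: cong_def)
    qed
    ultimately have "int p dvd K + (int a * int b) ^ (p - 2)"
      using assms(1) by (meson prime_dvd_multD prime_nat_int_transfer)
    then show ?thesis using False by (simp add: cong_iff_dvd_diff K_def)
  qed
qed

text \<open>Expand each product over pairs \<open>(a, b)\<close> and sum over \<open>i\<close>
  first. The part \<open>(a * b) ^ (p - 2)\<close> of the kernel factors into
  \<open>F(p - 2)^2\<close>, the wrapped-around pair \<open>i = j = p - 2\<close>; the diagonal part
  gives the squares of the quotients.\<close>

lemma fermat_moment_convolution:
  fixes p :: nat
  assumes "prime p" and "p \<ge> 3"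
  shows "[(\<Sum>i\<le>p - 3. fermat_moment p i * fermat_moment p (p - 3 - i)) =
     - (fermat_moment p (p - 2))\<^sup>2 - (\<Sum>a = 1..p - 1. (int_fermat_quotient p a)\<^sup>2 * int a ^ (p - 3))]
     (mod int p)"
proof -
  let ?q = "int_fermat_quotient p" and ?A = "{1..p - 1}"
  define L where "L = (\<Sum>a\<in>?A. \<Sum>b\<in>?A. ?q a * ?q b * (\<Sum>i\<le>p - 3. int a ^ i * int b ^ (p - 3 - i)))"
  define R where "R = (\<Sum>a\<in>?A. \<Sum>b\<in>?A. ?q a * ?q b *
      (- ((int a * int b) ^ (p - 2)) - (if a = b then int a ^ (p - 3) else 0)))"
  have "(\<Sum>i\<le>p - 3. fermat_moment p i * fermat_moment p (p - 3 - i)) =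
      (\<Sum>i\<le>p - 3. \<Sum>a\<in>?A. \<Sum>b\<in>?A. ?q a * ?q b * (int a ^ i * int b ^ (p - 3 - i)))"
    unfolding fermat_moment_def sum_product by (intro sum.cong refl) simp
  also have "\<dots> = (\<Sum>a\<in>?A. \<Sum>b\<in>?A. \<Sum>i\<le>p - 3. ?q a * ?q b * (int a ^ i * int b ^ (p - 3 - i)))"
    by (rule trans[OF sum.swap], rule sum.cong[OF refl], rule sum.swap)
  also have "\<dots> = L"
    by (simp add: L_def sum_distrib_left)
  finally have L: "(\<Sum>i\<le>p - 3. fermat_moment p i * fermat_moment p (p - 3 - i)) = L" .
  have "?q a * ?q b * (- ((int a * int b) ^ (p - 2)) - (if a = b then int a ^ (p - 3) else 0)) =
      - ((?q a * int a ^ (p - 2)) * (?q b * int b ^ (p - 2)))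
      - (if a = b then (?q a)\<^sup>2 * int a ^ (p - 3) else 0)" for a b
    unfolding power_mult_distrib by (auto simp: algebra_simps power2_eq_square)
  then have "R =
      - (\<Sum>a\<in>?A. \<Sum>b\<in>?A. (?q a * int a ^ (p - 2)) * (?q b * int b ^ (p - 2)))
      - (\<Sum>a\<in>?A. \<Sum>b\<in>?A. if a = b then (?q a)\<^sup>2 * int a ^ (p - 3) else 0)"
    unfolding R_def by (simp only: sum_subtractf sum_negf)
  also have "\<dots> = - (fermat_moment p (p - 2))\<^sup>2 - (\<Sum>a = 1..p - 1. (?q a)\<^sup>2 * int a ^ (p - 3))"
    by (simp add: fermat_moment_def power2_eq_square sum_product)
  finally have R: "R = - (fermat_moment p (p - 2))\<^sup>2 - (\<Sum>a = 1..p - 1. (?q a)\<^sup>2 * int a ^ (p - 3))" .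
  have "[L = R] (mod int p)"
    unfolding L_def R_def by (intro cong_sum cong_mult cong_refl complete_homogeneous_cong assms)
  then show ?thesis unfolding L R .
qed

section \<open>Arithmetic of p-integral rationals\<close>

lemma padic_integral_of_int [intro]: "prime p \<Longrightarrow> of_int z \<in> padic_integral_rats p"
  unfolding padic_integral_rats_def using prime_gt_1_nat[of p]
  by (intro CollectI exI[of _ z] exI[of _ 1]) auto

lemma padic_integral_of_nat [intro]: "prime p \<Longrightarrow> of_nat n \<in> padic_integral_rats p"
  using padic_integral_of_int[of p "int n"] by simp

lemma padic_integral_mult [intro]:
  assumes "prime p" and "x \<in> padic_integral_rats p" and "y \<in> padic_integral_rats p"
  shows "x * y \<in> padic_integral_rats p"
proof -
  obtain a b c d where "x = of_int a / of_int b" "\<not> int p dvd b"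
      "y = of_int c / of_int d" "\<not> int p dvd d"
    using assms unfolding padic_integral_rats_def by blast
  moreover from this have "\<not> int p dvd b * d"
    using assms(1) by (simp add: prime_dvd_mult_iff)
  ultimately show ?thesis unfolding padic_integral_rats_def
    by (intro CollectI exI[of _ "a * c"] exI[of _ "b * d"]) auto
qed

lemma padic_integral_add [intro]:
  assumes "prime p" and "x \<in> padic_integral_rats p" and "y \<in> padic_integral_rats p"
  shows "x + y \<in> padic_integral_rats p"
proof -
  obtain a b c d where *: "x = of_int a / of_int b" "\<not> int p dvd b"
      "y = of_int c / of_int d" "\<not> int p dvd d"
    using assms unfolding padic_integral_rats_def by blast
  then have "\<not> int p dvd b * d"
    using assms(1) by (simp add: prime_dvd_mult_iff)
  moreover have "b \<noteq> 0" "d \<noteq> 0" using * by auto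
  ultimately show ?thesis unfolding padic_integral_rats_def using *
    by (intro CollectI exI[of _ "a * d + c * b"] exI[of _ "b * d"]) (auto simp: field_simps)
qed

lemma padic_integral_uminus [intro]:
  "prime p \<Longrightarrow> x \<in> padic_integral_rats p \<Longrightarrow> - x \<in> padic_integral_rats p"
  using padic_integral_mult[of p "of_int (- 1)" x] padic_integral_of_int[of p "- 1"] by simp

lemma padic_integral_diff [intro]:
  "prime p \<Longrightarrow> x \<in> padic_integral_rats p \<Longrightarrow> y \<in> padic_integral_rats p \<Longrightarrow> x - y \<in> padic_integral_rats p"
  using padic_integral_add[of p x "- y"] by auto

lemma padic_integral_sum [intro]:
  assumes "prime p" and "\<And>i. i \<in> A \<Longrightarrow> f i \<in> padic_integral_rats p"
  shows "sum f A \<in> padic_integral_rats p"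
  using assms(2) padic_integral_of_int[OF assms(1), of 0]
  by (induction A rule: infinite_finite_induct) (auto simp: assms(1))

lemma padic_integral_divide_nat:
  assumes "prime p" and "x \<in> padic_integral_rats p" and "\<not> p dvd n"
  shows "x / of_nat n \<in> padic_integral_rats p"
proof -
  have "1 / of_nat n \<in> padic_integral_rats p"
    unfolding padic_integral_rats_def using assms(3)
    by (intro CollectI exI[of _ 1] exI[of _ "int n"]) auto
  then show ?thesis using padic_integral_mult[OF assms(1,2)] by fastforce
qed

lemma padic_integral_divide_fact:
  assumes "prime p" and "x \<in> padic_integral_rats p" and "n < p"
  shows "x / fact n \<in> padic_integral_rats p"
  using padic_integral_divide_nat[OF assms(1,2), of "fact n"] assms
  by (simp add: prime_dvd_fact_iff)

lemma padic_cong_refl [intro]: "prime p \<Longrightarrow> padic_cong p k x x"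
  unfolding padic_cong_def using padic_integral_of_int[of p 0] by (intro bexI[of _ 0]) auto

lemma padic_cong_sym: "prime p \<Longrightarrow> padic_cong p k x y \<Longrightarrow> padic_cong p k y x"
  unfolding padic_cong_def
  by (metis minus_diff_eq mult_minus_right padic_integral_uminus)

lemma padic_cong_add:
  assumes "prime p" and "padic_cong p k x y" and "padic_cong p k x' y'"
  shows "padic_cong p k (x + x') (y + y')"
proof -
  obtain z z' where "z \<in> padic_integral_rats p" "x - y = of_nat p ^ k * z"
      "z' \<in> padic_integral_rats p" "x' - y' = of_nat p ^ k * z'"
    using assms unfolding padic_cong_def by blast
  then show ?thesis unfolding padic_cong_def using assms(1)
    by (intro bexI[of _ "z + z'"]) (auto simp: algebra_simps)
qed

lemma padic_cong_trans:
  assumes "prime p" and "padic_cong p k x y" and "padic_cong p k y z"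
  shows "padic_cong p k x z"
  using padic_cong_add[OF assms(1) assms(2,3)] unfolding padic_cong_def by (simp add: algebra_simps)

lemma padic_cong_mult_left:
  assumes "prime p" and "padic_cong p k x y" and "c \<in> padic_integral_rats p"
  shows "padic_cong p k (c * x) (c * y)"
proof -
  obtain z where "z \<in> padic_integral_rats p" "x - y = of_nat p ^ k * z"
    using assms unfolding padic_cong_def by blast
  then show ?thesis unfolding padic_cong_def using assms
    by (intro bexI[of _ "c * z"]) (auto simp flip: right_diff_distrib)
qed

lemma padic_cong_uminus: "prime p \<Longrightarrow> padic_cong p k x y \<Longrightarrow> padic_cong p k (- x) (- y)"
  using padic_cong_mult_left[of p k x y "of_int (- 1)"] padic_integral_of_int[of p "- 1"] by simp

lemma padic_cong_diff:
  "prime p \<Longrightarrow> padic_cong p k x y \<Longrightarrow> padic_cong p k x' y' \<Longrightarrow> padic_cong p k (x - x') (y - y')"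
  using padic_cong_add[of p k x y "- x'" "- y'"] padic_cong_uminus[of p k x' y'] by simp

text \<open>The chain passes through \<open>y * x'\<close>, whence integrality of exactly these two
  factors.\<close>

lemma padic_cong_mult:
  assumes "prime p" and "padic_cong p k x y" and "padic_cong p k x' y'"
    and "y \<in> padic_integral_rats p" and "x' \<in> padic_integral_rats p"
  shows "padic_cong p k (x * x') (y * y')"
  using padic_cong_trans[OF assms(1) padic_cong_mult_left[OF assms(1,2,5)]
      padic_cong_mult_left[OF assms(1,3,4), unfolded mult.commute[of y x']]]
  by (simp add: mult.commute)

lemma padic_cong_sum:
  assumes "prime p" and "\<And>i. i \<in> A \<Longrightarrow> padic_cong p k (f i) (g i)"
  shows "padic_cong p k (sum f A) (sum g A)"
  using assms(2) by (induction A rule: infinite_finite_induct) (auto intro: padic_cong_add assms(1))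

lemma padic_cong_of_int:
  assumes "prime p" and "[x = y] (mod int p ^ k)"
  shows "padic_cong p k (of_int x) (of_int y)"
proof -
  obtain z where "x - y = int p ^ k * z"
    using assms(2) unfolding cong_iff_dvd_diff by blast
  then have "of_int x - of_int y = of_nat p ^ k * (of_int z :: rat)"
    by (metis of_int_diff of_int_mult of_int_of_nat_eq of_int_power)
  then show ?thesis unfolding padic_cong_def using assms(1) by blast
qed

section \<open>Bernoulli numbers modulo a prime\<close>

text \<open>Compares coefficients of \<open>X^n\<close> in \<open>bernoulli_num_egf\<close>; the
  term \<open>k = n\<close> drops out since \<open>e^X - 1\<close> has no constant term.\<close>

lemma bernoulli_num_recurrence:
  "(\<Sum>k<n. bernoulli_num k / fact k / fact (n - k)) = (if n = 1 then 1 else 0)"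
proof -
  have "(\<Sum>k\<le>n. bernoulli_num k / fact k * fps_nth (fps_exp 1 - 1) (n - k)) = fps_nth fps_X n"
    using arg_cong[OF bernoulli_num_egf, of "\<lambda>f. fps_nth f n"]
    by (simp add: fps_mult_nth atLeast0AtMost)
  also have "(\<Sum>k\<le>n. bernoulli_num k / fact k * fps_nth (fps_exp 1 - 1) (n - k)) =
      (\<Sum>k<n. bernoulli_num k / fact k * fps_nth (fps_exp 1 - 1) (n - k))"
    unfolding lessThan_Suc_atMost[symmetric] sum.lessThan_Suc by simp
  also have "\<dots> = (\<Sum>k<n. bernoulli_num k / fact k / fact (n - k))"
    by (intro sum.cong refl) simp
  finally show ?thesis by simp
qed

text \<open>The recurrence at \<open>Suc n\<close> expresses \<open>B_n / n!\<close> through earlier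
  values divided by factorials of at most \<open>n + 1 \<le> p - 1\<close>, which are prime to
  \<open>p\<close>.\<close>

lemma padic_integral_bernoulli:
  assumes "prime p" and "n \<le> p - 2"
  shows "bernoulli_num n / fact n \<in> padic_integral_rats p"
  using assms(2)
proof (induction n rule: less_induct)
  case (less n)
  have p: "p \<ge> 2" using assms(1) prime_ge_2_nat by blast
  have "bernoulli_num n / fact n =
      of_int (if n = 0 then 1 else 0) - (\<Sum>k<n. bernoulli_num k / fact k / fact (Suc n - k))"
    using bernoulli_num_recurrence[of "Suc n"] by auto
  moreover have "bernoulli_num k / fact k / fact (Suc n - k) \<in> padic_integral_rats p" if "k < n" for k
    using less that p by (intro padic_integral_divide_fact[OF assms(1) less.IH]) auto
  ultimately show ?case using assms(1) padic_integral_of_int[of p 1] by auto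
qed

text \<open>Faulhaber's formula: the geometric sum of the \<open>e^(aX)\<close>, multiplied by
  \<open>X\<close>, is the Bernoulli series times \<open>e^(mX) - 1\<close>; compare coefficients of
  \<open>X^(n+1)\<close>.\<close>

lemma power_sum_bernoulli:
  "(\<Sum>a<m. of_nat a ^ n) =
    fact n * (\<Sum>k\<le>n. bernoulli_num k / fact k * of_nat m ^ (Suc n - k) / fact (Suc n - k))"
proof -
  let ?B = "Abs_fps (\<lambda>n. bernoulli_num n / fact n)"
  have "(\<Sum>a<m. fps_exp (of_nat a)) * (fps_exp 1 - 1) = fps_exp (of_nat m :: rat) - 1"
    by (induction m) (simp_all add: algebra_simps fps_exp_add_mult)
  then have "fps_X * (\<Sum>a<m. fps_exp (of_nat a)) = ?B * (fps_exp (of_nat m) - 1)"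
    unfolding bernoulli_num_egf[symmetric] by (simp add: mult_ac)
  then have "fps_nth (fps_X * (\<Sum>a<m. fps_exp (of_nat a :: rat))) (Suc n) =
      fps_nth (?B * (fps_exp (of_nat m) - 1)) (Suc n)" by simp
  moreover have "fps_nth (fps_X * (\<Sum>a<m. fps_exp (of_nat a :: rat))) (Suc n) =
      (\<Sum>a<m. of_nat a ^ n) / fact n"
    by (simp add: fps_sum_nth sum_divide_distrib)
  moreover have "fps_nth (?B * (fps_exp (of_nat m) - 1)) (Suc n) =
      (\<Sum>k\<le>n. bernoulli_num k / fact k * of_nat m ^ (Suc n - k) / fact (Suc n - k))"
    unfolding fps_mult_nth atLeast0AtMost sum.atMost_Suc by (auto intro!: sum.cong)
  ultimately show ?thesis by (simp add: field_simps)
qed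

text \<open>In Faulhaber's formula with \<open>m = p\<close> the term \<open>k = n\<close> is
  \<open>p * B_n\<close>; every other term has a power of \<open>p\<close> of exponent at least 2
  and a \<open>p\<close>-integral cofactor.\<close>

lemma power_sum_cong_bernoulli:
  assumes "prime p" and "0 < n" and "n \<le> p - 2"
  shows "padic_cong p 2 (\<Sum>a = 1..p - 1. of_nat a ^ n) (of_nat p * bernoulli_num n)"
proof -
  let ?P = "padic_integral_rats p"
  define z where "z = (\<Sum>k<n. fact n * (bernoulli_num k / fact k * of_nat p ^ (n - 1 - k) / fact (Suc n - k)))"
  have p: "p \<ge> 2" using assms(1) prime_ge_2_nat by blast
  have "(\<Sum>a = 1..p - 1. of_nat a ^ n) = (\<Sum>a<p. of_nat a ^ n :: rat)"
    using assms p by (intro sum.mono_neutral_left) auto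
  also have "\<dots> = (\<Sum>k<n. of_nat p ^ 2 *
      (fact n * (bernoulli_num k / fact k * of_nat p ^ (n - 1 - k) / fact (Suc n - k))))
      + of_nat p * bernoulli_num n"
    unfolding power_sum_bernoulli lessThan_Suc_atMost[symmetric] sum.lessThan_Suc distrib_left
      sum_distrib_left
  proof (intro arg_cong2[of _ _ _ _ "(+)"] sum.cong refl)
    fix k assume "k \<in> {..<n}"
    then have "Suc n - k = 2 + (n - 1 - k)" by auto
    then have "of_nat p ^ (Suc n - k) = (of_nat p ^ 2 * of_nat p ^ (n - 1 - k) :: rat)"
      by (metis power_add)
    then show "fact n * (bernoulli_num k / fact k * of_nat p ^ (Suc n - k) / fact (Suc n - k)) =
        of_nat p ^ 2 * (fact n * (bernoulli_num k / fact k * of_nat p ^ (n - 1 - k) / fact (Suc n - k)))"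
      by simp
  qed simp
  finally have "(\<Sum>a = 1..p - 1. of_nat a ^ n) - of_nat p * bernoulli_num n = of_nat p ^ 2 * z"
    by (simp add: z_def sum_distrib_left)
  moreover have "z \<in> ?P"
    unfolding z_def
  proof (rule padic_integral_sum[OF assms(1)])
    fix k assume k: "k \<in> {..<n}"
    have "fact n \<in> ?P" "of_nat p ^ (n - 1 - k) \<in> ?P"
      using padic_integral_of_nat[OF assms(1), of "fact n"]
        padic_integral_of_nat[OF assms(1), of "p ^ (n - 1 - k)"] by simp_all
    moreover have "bernoulli_num k / fact k \<in> ?P"
      using k assms by (intro padic_integral_bernoulli) auto
    ultimately show "fact n * (bernoulli_num k / fact k * of_nat p ^ (n - 1 - k) / fact (Suc n - k)) \<in> ?P"
      using assms p k
      by (intro padic_integral_mult[OF _ _ padic_integral_divide_fact[OF _ padic_integral_mult]]) auto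
  qed
  ultimately show ?thesis unfolding padic_cong_def by blast
qed

text \<open>Modulo \<open>p^2\<close> the sum of the \<open>a ^ i\<close> is both
  \<open>p * B_i\<close> and \<open>- i * p * F(i)\<close>. Cancelling \<open>p\<close> lowers the
  modulus to \<open>p\<close>, and \<open>i\<close> is prime to \<open>p\<close>.\<close>

lemma div_bernoulli_cong:
  assumes "prime p" and "0 < i" and "i \<le> p - 2"
  shows "padic_cong p 1 (div_bernoulli i) (- of_int (fermat_moment p i))"
proof -
  let ?S = "\<Sum>a = 1..p - 1. of_nat a ^ i :: rat" and ?F = "of_int (fermat_moment p i) :: rat"
  have p: "p > 0" "i < p" "i < p - 1" using assms by auto
  have "padic_cong p 2 (?S + of_nat i * of_nat p * ?F) 0"
    using padic_cong_of_int[OF assms(1) power_sum_fermat_moment[OF assms(1,2) p(3)]] by simp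
  then have "padic_cong p 2 (of_nat p * bernoulli_num i - ?S + (?S + of_nat i * of_nat p * ?F)) 0"
    using padic_cong_add[OF assms(1)
        padic_cong_diff[OF assms(1) padic_cong_sym[OF assms(1) power_sum_cong_bernoulli[OF assms]]
          padic_cong_refl[OF assms(1)], of ?S]]
    by fastforce
  then obtain z where z: "z \<in> padic_integral_rats p"
      "of_nat p * (bernoulli_num i + of_nat i * ?F) = of_nat p * (of_nat p * z)"
    unfolding padic_cong_def by (auto simp: algebra_simps power2_eq_square)
  then have "bernoulli_num i + of_nat i * ?F = of_nat p * z" using p by simp
  then have "div_bernoulli i - (- ?F) = of_nat p ^ 1 * (z / of_nat i)"
    using assms(2) by (simp add: div_bernoulli_def field_simps)
  moreover have "z / of_nat i \<in> padic_integral_rats p"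
    using z assms p by (intro padic_integral_divide_nat) (auto dest: dvd_imp_le)
  ultimately show ?thesis unfolding padic_cong_def by blast
qed

section \<open>Rational Fermat quotients and the final congruence\<close>

lemma of_int_int_fermat_quotient:
  assumes "prime p" and "a \<in> {1..p - 1}"
  shows "of_int (int_fermat_quotient p a) = fermat_quotient p a"
proof -
  have "of_int (int a ^ (p - 1)) = (of_int (1 + int p * int_fermat_quotient p a) :: rat)"
    using mult_int_fermat_quotient[OF assms] by simp
  then show ?thesis
    using prime_gt_0_nat[OF assms(1)] by (simp add: fermat_quotient_def)
qed

text \<open>Since \<open>a ^ (p - 3)\<close> equals \<open>(1 + p * q) / a^2\<close> exactly, the
  difference of the two sides is \<open>- p * q^3 / a^2\<close>.\<close>

lemma fermat_quotient_square_divide_cong: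
  assumes "prime p" and "p \<ge> 3" and "a \<in> {1..p - 1}"
  shows "padic_cong p 1 ((fermat_quotient p a)\<^sup>2 / (of_nat a)\<^sup>2)
    (of_int ((int_fermat_quotient p a)\<^sup>2 * int a ^ (p - 3)))"
proof -
  define q where "q = (of_int (int_fermat_quotient p a) :: rat)"
  have q: "fermat_quotient p a = q"
    using of_int_int_fermat_quotient[OF assms(1,3)] by (simp add: q_def)
  have pw: "of_nat a ^ (p - 1) = 1 + of_nat p * q"
    using q prime_gt_0_nat[OF assms(1)] by (auto simp: fermat_quotient_def)
  have "p - 1 = (p - 3) + 2" using assms by simp
  then have "of_nat a ^ (p - 3) * (of_nat a)\<^sup>2 = 1 + of_nat p * q"
    using pw by (metis power_add)
  moreover have "(of_nat a :: rat)\<^sup>2 \<noteq> 0" using assms by auto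
  ultimately have "of_nat a ^ (p - 3) = (1 + of_nat p * q) / (of_nat a)\<^sup>2"
    by (simp add: eq_divide_eq)
  then have "q\<^sup>2 / (of_nat a)\<^sup>2 - q\<^sup>2 * of_nat a ^ (p - 3) = of_nat p ^ 1 * (- (q ^ 3) / of_nat (a ^ 2))"
    by (simp add: field_simps power2_eq_square power3_eq_cube add_divide_distrib)
  moreover have "- (q ^ 3) / of_nat (a ^ 2) \<in> padic_integral_rats p"
  proof (rule padic_integral_divide_nat[OF assms(1)])
    show "- (q ^ 3) \<in> padic_integral_rats p"
      using padic_integral_of_int[OF assms(1), of "- (int_fermat_quotient p a ^ 3)"] by (simp add: q_def)
    have "\<not> p dvd a" using assms by (auto dest: dvd_imp_le)
    then show "\<not> p dvd a ^ 2" using assms(1) prime_dvd_power by blast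
  qed
  ultimately show ?thesis unfolding padic_cong_def q
    by (intro bexI[of _ "- (q ^ 3) / of_nat (a ^ 2)"]) (simp_all add: q_def)
qed

theorem theorem0p2:
  fixes p :: nat
  assumes "prime p" and "p \<ge> 7"
  shows "padic_cong p 1
    (\<Sum>i = 2..p - 5. div_bernoulli i * div_bernoulli (p - 3 - i))
    (2 * wilson_quotient p * div_bernoulli (p - 3)
      - (\<Sum>a = 1..p - 1. (fermat_quotient p a)\<^sup>2 / (of_nat a)\<^sup>2))"
proof -
  let ?F = "fermat_moment p" and ?P = "padic_integral_rats p"
  define C where "C = (\<Sum>i = 2..p - 5. ?F i * ?F (p - 3 - i))"
  define Q where "Q = (\<Sum>a = 1..p - 1. (int_fermat_quotient p a)\<^sup>2 * int a ^ (p - 3))"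
  have odd: "odd p" using assms prime_odd_nat by simp
  have "int p dvd fact (p - 1) + 1"
    using wilson_theorem[OF assms(1)] by (simp add: cong_iff_dvd_diff)
  then obtain w where w: "fact (p - 1) + 1 = int p * w" by blast
  have "of_int (fact (p - 1) + 1) = (of_int (int p * w) :: rat)" using w by simp
  then have wq: "wilson_quotient p = of_int w"
    using assms(2) by (simp add: wilson_quotient_def)
  have F_odd: "[?F i = 0] (mod int p)" if "odd i" "2 < i" "i < p - 1" for i
    using fermat_moment_odd assms(1) that by blast

  \<comment> \<open>The outer indices 0, 1, \<open>p - 4\<close>, \<open>p - 3\<close> are distinct
    because \<open>p \<ge> 7\<close>; the symmetry of the convolution doubles their two
    products.\<close>
  have split: "(\<Sum>i\<le>p - 3. ?F i * ?F (p - 3 - i)) = 2 * ?F 0 * ?F (p - 3) + 2 * ?F 1 * ?F (p - 4) + C"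
  proof -
    have "{..p - 3} = {0, 1, p - 4, p - 3} \<union> {2..p - 5}" using assms(2) by auto
    then have "(\<Sum>i\<le>p - 3. ?F i * ?F (p - 3 - i)) = (\<Sum>i\<in>{0, 1, p - 4, p - 3}. ?F i * ?F (p - 3 - i)) + C"
      unfolding C_def using assms(2) by (simp only:) (intro sum.union_disjoint, auto)
    moreover obtain k where "p = 7 + k" using le_Suc_ex[OF assms(2)] by blast
    ultimately show ?thesis by (simp add: algebra_simps)
  qed
  \<comment> \<open>Lerch replaces \<open>F(0)\<close> by \<open>w\<close>. The index
    \<open>p - 4\<close> is odd and at least 3, so its moment vanishes and with it the product
    containing \<open>F(1)\<close>.\<close>
  have "[2 * w * ?F (p - 3) + 2 * ?F 1 * 0 + C = 2 * ?F 0 * ?F (p - 3) + 2 * ?F 1 * ?F (p - 4) + C] (mod int p)"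
    using assms odd
    by (intro cong_add cong_mult cong_refl cong_sym[OF F_odd] cong_sym[OF fermat_moment_0[OF _ _ w]]) auto
  also have "[2 * ?F 0 * ?F (p - 3) + 2 * ?F 1 * ?F (p - 4) + C = - (?F (p - 2))\<^sup>2 - Q] (mod int p)"
    using fermat_moment_convolution[OF assms(1)] assms(2) unfolding split Q_def by simp
  \<comment> \<open>The wrapped-around square vanishes too, \<open>p - 2\<close> being odd.\<close>
  also have "[- (?F (p - 2))\<^sup>2 - Q = - 0\<^sup>2 - Q] (mod int p)"
    using assms odd
    by (intro cong_diff cong_refl iffD2[OF cong_minus_minus_iff] cong_pow F_odd) auto
  finally have "[C = 2 * w * (- ?F (p - 3)) - Q] (mod int p)"
    by (simp add: cong_iff_dvd_diff algebra_simps)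
  then have main: "padic_cong p 1 (of_int C) (2 * wilson_quotient p * (- of_int (?F (p - 3))) - of_int Q)"
    using padic_cong_of_int[OF assms(1), of _ _ 1] wq by fastforce

  have int_F: "- of_int (?F i) \<in> ?P" for i
    using assms(1) by auto
  have cong_F: "padic_cong p 1 (div_bernoulli i) (- of_int (?F i))" if "0 < i" "i \<le> p - 2" for i
    using div_bernoulli_cong assms(1) that by blast
  \<comment> \<open>A rational congruent to an integer modulo \<open>p\<close> is
    \<open>p\<close>-integral.\<close>
  have int_B: "div_bernoulli i \<in> ?P" if "0 < i" "i \<le> p - 2" for i
  proof -
    obtain z where z: "z \<in> ?P" "div_bernoulli i = - of_int (?F i) + of_nat p * z"
      using cong_F[OF \<open>0 < i\<close> \<open>i \<le> p - 2\<close>] unfolding padic_cong_def by (auto simp: algebra_simps)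
    show ?thesis unfolding z(2)
      by (intro padic_integral_add padic_integral_mult padic_integral_of_nat int_F z(1) assms(1))
  qed

  \<comment> \<open>The signs from \<open>B_i / i = - F(i)\<close> cancel in each product, but
    survive in the single factor \<open>F(p - 3)\<close>.\<close>
  have C: "of_int C = (\<Sum>i = 2..p - 5. (- of_int (?F i)) * (- of_int (?F (p - 3 - i))) :: rat)"
    by (simp add: C_def)
  have "padic_cong p 1 (\<Sum>i = 2..p - 5. div_bernoulli i * div_bernoulli (p - 3 - i)) (of_int C)"
    unfolding C using assms(2)
    by (intro padic_cong_sum[OF assms(1)] padic_cong_mult[OF assms(1)] cong_F int_F int_B) auto
  moreover have "padic_cong p 1 (2 * wilson_quotient p * (- of_int (?F (p - 3))) - of_int Q)
      (2 * wilson_quotient p * div_bernoulli (p - 3)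
        - (\<Sum>a = 1..p - 1. (fermat_quotient p a)\<^sup>2 / (of_nat a)\<^sup>2))"
  proof (rule padic_cong_diff[OF assms(1) padic_cong_mult_left[OF assms(1) padic_cong_sym[OF assms(1)]]
        padic_cong_sym[OF assms(1)]])
    show "padic_cong p 1 (div_bernoulli (p - 3)) (- of_int (?F (p - 3)))"
      using assms by (intro cong_F) auto
    show "2 * wilson_quotient p \<in> ?P"
      using padic_integral_of_int[OF assms(1), of "2 * w"] wq by simp
    show "padic_cong p 1 (\<Sum>a = 1..p - 1. (fermat_quotient p a)\<^sup>2 / (of_nat a)\<^sup>2) (of_int Q)"
      unfolding Q_def of_int_sum using assms
      by (intro padic_cong_sum[OF assms(1)] fermat_quotient_square_divide_cong) auto
  qed
  ultimately show ?thesis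
    using main padic_cong_trans[OF assms(1)] by blast
qed

end
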